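(* Let $i\in\mathcal S$ be the initial regime and let the standing assumptions on the coefficients (given in the context) hold. If $\gamma>0$ satisfies $\overline V^0_\gamma(0,0,i)=0$, then $\gamma\ge\bar\gamma$, where $$\bar\gamma:=\inf\bar\Gamma,\qquad \bar\Gamma:=\{\gamma>0:\ \overline V^0_{\gamma'}(0,0,i)=0\ \text{ for all }\gamma'>\gamma\}.$$
   Context: Let $T\in(0,\infty)$. On a complete probability space $(\Omega,\mathcal F,\mathbb P)$ let $W,\overline W$ be independent one-dimensional standard Brownian motions and let $\alpha$ be a continuous-time homogeneous irreducible Markov chain, independent of $(W,\overline W)$, with finite state space $\mathcal S=\{1,\dots,D\}$ and generator $(\lambda_{ij})_{i,j=1}^D$, $\lambda_{ij}>0$ for $i\ne j$, $\sum_j\lambda_{ij}=0$. $\mathbb F=\{\mathcal F_t\}$ is the filtration generated by $(W,\overline W,\alpha)$ and $\mathbb G=\{\mathcal G_t\}$ the filtration generated by $(W,\alpha)$, both augmented by the $\mathbb P$-null sets. $L^2_{\mathbb F}(0,T;\mathbb R^k)$ (resp. $L^2_{\mathbb G}(0,T;\mathbb R^k)$) is the set of $\mathbb F$- (resp. $\mathbb G$-) progressively measurable $\mathbb R^k$-valued processes $\phi$ with $\mathbb E\int_0^T|\phi(s)|^2ds<\infty$. $\mathbb S^n$ is the set of real symmetric $n\times n$ matrices. $M\gg0$ means $M\ge\delta I$ for some constant $\delta>0$ (uniformly in a.e. $s$). Coefficients (deterministic, for each $j\in\mathcal S$): $A(\cdot,j)\in L^1(0,T;\mathbb R^{n\times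 n})$; $C(\cdot,j),\bar C(\cdot,j)\in L^2(0,T;\mathbb R^{n\times n})$; $B=(B_1\ B_2)$ with $B(\cdot,j)\in L^2(0,T;\mathbb R^{n\times(m+n_v)})$; $D=(D_1\ D_2)$, $\bar D=(\bar D_1\ \bar D_2)$ with $D(\cdot,j),\bar D(\cdot,j)\in L^\infty(0,T;\mathbb R^{n\times(m+n_v)})$; $Q(\cdot,j)\in L^1(0,T;\mathbb S^n)$; $S=\binom{S_1}{S_2}$ with $S(\cdot,j)\in L^2(0,T;\mathbb R^{(m+n_v)\times n})$; $R=\mathrm{diag}(R_1,R_2)$ with $R(\cdot,j)\in L^\infty(0,T;\mathbb S^{m+n_v})$; $G(T,j)\in\mathbb S^n$. The indices $1,2$ refer to the blocks of sizes $m$ and $n_v$. Moreover, for every $j\in\mathcal S$ and a.e. $s\in[0,T]$: $G(T,j)\ge0$, $R(s,j)\gg0$, $Q(s,j)-S(s,j)^\top R(s,j)^{-1}S(s,j)\ge0$. For $u\in L^2_{\mathbb G}(0,T;\mathbb R^m)$ and $v\in L^2_{\mathbb F}(0,T;\mathbb R^{n_v})$ let $x^0$ be the solution (coefficients evaluated at $(s,\alpha(s))$) of $$dx^0=[Ax^0+B_1u+B_2v]ds+[Cx^0+D_1u+D_2v]dW+[\bar Cx^0+\bar D_1u+\bar D_2v]d\overline W,\quad x^0(0)=0,\ \alpha(0)=i,$$ and set $$J^0(0,0,i;u,v)=\mathbb E\Big\{\langle G(T,\alpha(T))x^0(T),x^0(T)\rangle+\int_0^T\big[\langle Qx^0,x^0\rangle+\langle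 R_1u,u\rangle+\langle R_2v,v\rangle+2\langle S_1x^0,u\rangle+2\langle S_2x^0,v\rangle\big]ds\Big\},$$ $$J^0_\gamma(0,0,i;u,v)=J^0(0,0,i;u,v)-\gamma^2\,\mathbb E\int_0^T|v(s)|^2ds.$$ The open-loop upper value (an extended real number) is $$\overline V^0_\gamma(0,0,i)=\inf_{u\in L^2_{\mathbb G}(0,T;\mathbb R^m)}\ \sup_{v\in L^2_{\mathbb F}(0,T;\mathbb R^{n_v})}J^0_\gamma(0,0,i;u,v).$$ *)

theory Defs
  imports "HOL-Probability.Probability"
begin

section \<open>Processes, filtrations and progressive measurability\<close>

text \<open>
  A process is a function of time and of the sample point; only its values at times
  \<open>t \<ge> 0\<close> are meaningful.
\<close>

definition history ::
    "'w measure \<Rightarrow> 'b measure \<Rightarrow> (real \<Rightarrow> 'w \<Rightarrow> 'b) \<Rightarrow> real set \<Rightarrow> 'w set set" where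
  "history M N X I = {X r -` B \<inter> space M | r B. r \<in> I \<and> B \<in> sets N}"

definition filtration_F ::
    "'w measure \<Rightarrow> (real \<Rightarrow> 'w \<Rightarrow> real) \<Rightarrow> (real \<Rightarrow> 'w \<Rightarrow> real) \<Rightarrow> (real \<Rightarrow> 'w \<Rightarrow> nat)
      \<Rightarrow> real \<Rightarrow> 'w measure" where
  "filtration_F M W Wb \<alpha> t =
     sigma (space M) (history M borel W {0..t} \<union> history M borel Wb {0..t}
       \<union> history M (count_space UNIV) \<alpha> {0..t} \<union> null_sets M)"

definition filtration_G ::
    "'w measure \<Rightarrow> (real \<Rightarrow> 'w \<Rightarrow> real) \<Rightarrow> (real \<Rightarrow> 'w \<Rightarrow> nat) \<Rightarrow> real \<Rightarrow> 'w measure" where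
  "filtration_G M W \<alpha> t =
     sigma (space M) (history M borel W {0..t} \<union> history M (count_space UNIV) \<alpha> {0..t} \<union> null_sets M)"

definition progressive ::
    "(real \<Rightarrow> 'w measure) \<Rightarrow> real \<Rightarrow> (real \<Rightarrow> 'w \<Rightarrow> 'b::topological_space) \<Rightarrow> bool" where
  "progressive F T \<phi> \<longleftrightarrow>
     (\<forall>t\<in>{0..T}. (\<lambda>(s, \<omega>). \<phi> s \<omega>) \<in> borel_measurable (restrict_space borel {0..t} \<Otimes>\<^sub>M F t))"

definition L2_processes ::
    "'w measure \<Rightarrow> (real \<Rightarrow> 'w measure) \<Rightarrow> real \<Rightarrow> (real \<Rightarrow> 'w \<Rightarrow> 'b::real_normed_vector) set" where
  "L2_processes M F T =
     {\<phi>. progressive F T \<phi> \<and>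
         (\<integral>\<^sup>+\<omega>. (\<integral>\<^sup>+s\<in>{0..T}. ennreal ((norm (\<phi> s \<omega>))\<^sup>2) \<partial>lborel) \<partial>M) < \<infinity>}"


section \<open>Brownian motion and Markov chains\<close>

definition brownian_motion :: "'w measure \<Rightarrow> (real \<Rightarrow> 'w \<Rightarrow> real) \<Rightarrow> bool" where
  "brownian_motion M W \<longleftrightarrow>
     (\<forall>t\<ge>0. W t \<in> borel_measurable M) \<and>
     (AE \<omega> in M. W 0 \<omega> = 0) \<and>
     (AE \<omega> in M. continuous_on {0..} (\<lambda>t. W t \<omega>)) \<and>
     (\<forall>s t. 0 \<le> s \<and> s < t \<longrightarrow>
        distributed M lborel (\<lambda>\<omega>. W t \<omega> - W s \<omega>) (normal_density 0 (sqrt (t - s))) \<and>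
        prob_space.indep_set M
          (sets (vimage_algebra (space M) (\<lambda>\<omega>. W t \<omega> - W s \<omega>) borel))
          (sigma_sets (space M) (history M borel W {0..s})))"

definition transition_semigroup :: "nat set \<Rightarrow> (real \<Rightarrow> nat \<Rightarrow> nat \<Rightarrow> real) \<Rightarrow> bool" where
  "transition_semigroup S p \<longleftrightarrow>
     (\<forall>t\<ge>0. \<forall>k\<in>S. (\<forall>j\<in>S. 0 \<le> p t k j) \<and> (\<Sum>j\<in>S. p t k j) = 1) \<and>
     (\<forall>k\<in>S. \<forall>j\<in>S. p 0 k j = (if k = j then 1 else 0)) \<and>
     (\<forall>s\<ge>0. \<forall>t\<ge>0. \<forall>k\<in>S. \<forall>j\<in>S. p (s + t) k j = (\<Sum>l\<in>S. p s k l * p t l j))"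

definition has_generator ::
    "nat set \<Rightarrow> (real \<Rightarrow> nat \<Rightarrow> nat \<Rightarrow> real) \<Rightarrow> (nat \<Rightarrow> nat \<Rightarrow> real) \<Rightarrow> bool" where
  "has_generator S p rate \<longleftrightarrow>
     (\<forall>k\<in>S. \<forall>j\<in>S.
        ((\<lambda>h. (p h k j - (if k = j then 1 else 0)) / h) \<longlongrightarrow> rate k j) (at_right 0))"

text \<open>
  A homogeneous irreducible chain with finite state space \<open>S\<close>. The path condition is right
  continuity with left limits, spelled out for a discrete state space; it is required for
  every sample point, so that the chain is progressively measurable.
\<close>

definition irreducible_markov_chain ::
    "'w measure \<Rightarrow> nat set \<Rightarrow> (nat \<Rightarrow> nat \<Rightarrow> real) \<Rightarrow> (real \<Rightarrow> 'w \<Rightarrow> nat) \<Rightarrow> bool" where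
  "irreducible_markov_chain M S rate \<alpha> \<longleftrightarrow>
     (\<forall>t\<ge>0. \<alpha> t \<in> measurable M (count_space S)) \<and>
     (\<forall>\<omega>\<in>space M. \<forall>t\<ge>0. eventually (\<lambda>s. \<alpha> s \<omega> = \<alpha> t \<omega>) (at_right t)) \<and>
     (\<forall>\<omega>\<in>space M. \<forall>t>0. \<exists>l. eventually (\<lambda>s. \<alpha> s \<omega> = l) (at_left t)) \<and>
     (\<exists>p. transition_semigroup S p \<and> has_generator S p rate \<and>
        (\<forall>k\<in>S. \<forall>j\<in>S. \<exists>t>0. p t k j > 0) \<and>
        (\<forall>s\<ge>0. \<forall>t\<ge>0. \<forall>k\<in>S. \<forall>j\<in>S.
           \<forall>E \<in> sigma_sets (space M) (history M (count_space UNIV) \<alpha> {0..s}).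
             measure M (E \<inter> {\<omega>\<in>space M. \<alpha> s \<omega> = k \<and> \<alpha> (s + t) \<omega> = j})
               = measure M (E \<inter> {\<omega>\<in>space M. \<alpha> s \<omega> = k}) * p t k j))"

text \<open>\<open>W\<close> and \<open>Wb\<close> are independent, and \<open>\<alpha>\<close> is independent of the pair \<open>(W, Wb)\<close>.\<close>

definition independent_noise ::
    "'w measure \<Rightarrow> (real \<Rightarrow> 'w \<Rightarrow> real) \<Rightarrow> (real \<Rightarrow> 'w \<Rightarrow> real) \<Rightarrow> (real \<Rightarrow> 'w \<Rightarrow> nat) \<Rightarrow> bool" where
  "independent_noise M W Wb \<alpha> \<longleftrightarrow>
     prob_space.indep_set M
       (sigma_sets (space M) (history M borel W {0..}))
       (sigma_sets (space M) (history M borel Wb {0..})) \<and>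
     prob_space.indep_set M
       (sigma_sets (space M) (history M borel W {0..} \<union> history M borel Wb {0..}))
       (sigma_sets (space M) (history M (count_space UNIV) \<alpha> {0..}))"


section \<open>The Ito integral\<close>

text \<open>
  The integral of a progressively measurable process with almost surely square integrable
  paths, as the limit in probability of the integrals of elementary processes
  \<open>\<Sum>k<N. \<xi> k * 1_(\<tau> k, \<tau> (k + 1)]\<close>. Together with continuity of paths this determines the
  integral process up to indistinguishability.
\<close>

definition elementary_process ::
    "'w measure \<Rightarrow> (real \<Rightarrow> 'w measure) \<Rightarrow> real \<Rightarrow> nat \<Rightarrow> (nat \<Rightarrow> real)
      \<Rightarrow> (nat \<Rightarrow> 'w \<Rightarrow> 'b::euclidean_space) \<Rightarrow> bool" where
  "elementary_process M F T N \<tau> \<xi> \<longleftrightarrow>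
     0 \<le> \<tau> 0 \<and> (\<forall>k<N. \<tau> k \<le> \<tau> (Suc k)) \<and> \<tau> N \<le> T \<and>
     (\<forall>k<N. \<xi> k \<in> borel_measurable (F (\<tau> k))) \<and>
     (\<exists>K. \<forall>k<N. \<forall>\<omega>\<in>space M. norm (\<xi> k \<omega>) \<le> K)"

definition elementary_value ::
    "nat \<Rightarrow> (nat \<Rightarrow> real) \<Rightarrow> (nat \<Rightarrow> 'w \<Rightarrow> 'b::euclidean_space) \<Rightarrow> real \<Rightarrow> 'w \<Rightarrow> 'b" where
  "elementary_value N \<tau> \<xi> s \<omega> = (\<Sum>k<N. indicator {\<tau> k<..\<tau> (Suc k)} s *\<^sub>R \<xi> k \<omega>)"

definition elementary_integral ::
    "(real \<Rightarrow> 'w \<Rightarrow> real) \<Rightarrow> nat \<Rightarrow> (nat \<Rightarrow> real) \<Rightarrow> (nat \<Rightarrow> 'w \<Rightarrow> 'b::euclidean_space)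
      \<Rightarrow> real \<Rightarrow> 'w \<Rightarrow> 'b" where
  "elementary_integral W N \<tau> \<xi> t \<omega> =
     (\<Sum>k<N. (W (min t (\<tau> (Suc k))) \<omega> - W (min t (\<tau> k)) \<omega>) *\<^sub>R \<xi> k \<omega>)"

definition null_in_probability :: "'w measure \<Rightarrow> (nat \<Rightarrow> 'w \<Rightarrow> ennreal) \<Rightarrow> bool" where
  "null_in_probability M X \<longleftrightarrow>
     (\<forall>n. X n \<in> borel_measurable M) \<and>
     (\<forall>\<epsilon>>0. (\<lambda>n. measure M {\<omega>\<in>space M. X n \<omega> > ennreal \<epsilon>}) \<longlonglongrightarrow> 0)"

definition has_ito_integral ::
    "'w measure \<Rightarrow> (real \<Rightarrow> 'w measure) \<Rightarrow> real \<Rightarrow> (real \<Rightarrow> 'w \<Rightarrow> real)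
      \<Rightarrow> (real \<Rightarrow> 'w \<Rightarrow> 'b::euclidean_space) \<Rightarrow> (real \<Rightarrow> 'w \<Rightarrow> 'b) \<Rightarrow> bool" where
  "has_ito_integral M F T W \<phi> Y \<longleftrightarrow>
     progressive F T \<phi> \<and>
     (AE \<omega> in M. (\<integral>\<^sup>+s\<in>{0..T}. ennreal ((norm (\<phi> s \<omega>))\<^sup>2) \<partial>lborel) < \<infinity>) \<and>
     (\<forall>t\<in>{0..T}. Y t \<in> borel_measurable (F t)) \<and>
     (AE \<omega> in M. continuous_on {0..T} (\<lambda>t. Y t \<omega>)) \<and>
     (\<exists>N \<tau> \<xi>.
        (\<forall>n. elementary_process M F T (N n) (\<tau> n) (\<xi> n)) \<and>
        null_in_probability M (\<lambda>n \<omega>. \<integral>\<^sup>+s\<in>{0..T}.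
          ennreal ((norm (elementary_value (N n) (\<tau> n) (\<xi> n) s \<omega> - \<phi> s \<omega>))\<^sup>2) \<partial>lborel) \<and>
        (\<forall>t\<in>{0..T}. null_in_probability M (\<lambda>n \<omega>.
          ennreal (norm (elementary_integral W (N n) (\<tau> n) (\<xi> n) t \<omega> - Y t \<omega>)))))"


section \<open>Coefficients\<close>

text \<open>
  The dimensions \<open>n\<close>, \<open>m\<close>, \<open>n_v\<close> are the cardinalities of the index types \<open>'n\<close>, \<open>'m\<close>, \<open>'v\<close>;
  the block index set of size \<open>m + n_v\<close> is \<open>'m + 'v\<close>. The coefficients with a bar are
  written with a suffix \<open>b\<close>; \<open>cG j\<close> is the terminal weight \<open>G(T, j)\<close>.
\<close>

record ('n, 'm, 'v) coeffs =
  cA :: "real \<Rightarrow> nat \<Rightarrow> real^'n^'n"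
  cB1 :: "real \<Rightarrow> nat \<Rightarrow> real^'m^'n"
  cB2 :: "real \<Rightarrow> nat \<Rightarrow> real^'v^'n"
  cC :: "real \<Rightarrow> nat \<Rightarrow> real^'n^'n"
  cD1 :: "real \<Rightarrow> nat \<Rightarrow> real^'m^'n"
  cD2 :: "real \<Rightarrow> nat \<Rightarrow> real^'v^'n"
  cCb :: "real \<Rightarrow> nat \<Rightarrow> real^'n^'n"
  cDb1 :: "real \<Rightarrow> nat \<Rightarrow> real^'m^'n"
  cDb2 :: "real \<Rightarrow> nat \<Rightarrow> real^'v^'n"
  cQ :: "real \<Rightarrow> nat \<Rightarrow> real^'n^'n"
  cS1 :: "real \<Rightarrow> nat \<Rightarrow> real^'n^'m"
  cS2 :: "real \<Rightarrow> nat \<Rightarrow> real^'n^'v"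
  cR1 :: "real \<Rightarrow> nat \<Rightarrow> real^'m^'m"
  cR2 :: "real \<Rightarrow> nat \<Rightarrow> real^'v^'v"
  cG :: "nat \<Rightarrow> real^'n^'n"

definition hblock :: "real^'m^'n \<Rightarrow> real^'v^'n \<Rightarrow> real^('m + 'v)^'n" where
  "hblock X Y = (\<chi> a b. case b of Inl k \<Rightarrow> X $ a $ k | Inr l \<Rightarrow> Y $ a $ l)"

definition vblock :: "real^'n^'m \<Rightarrow> real^'n^'v \<Rightarrow> real^'n^('m + 'v)" where
  "vblock X Y = (\<chi> a. case a of Inl k \<Rightarrow> X $ k | Inr l \<Rightarrow> Y $ l)"

definition diagblock :: "real^'m^'m \<Rightarrow> real^'v^'v \<Rightarrow> real^('m + 'v)^('m + 'v)" where
  "diagblock X Y = (\<chi> a b. case (a, b) of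
       (Inl k, Inl l) \<Rightarrow> X $ k $ l
     | (Inr k, Inr l) \<Rightarrow> Y $ k $ l
     | _ \<Rightarrow> 0)"

definition cB where "cB c s j = hblock (cB1 c s j) (cB2 c s j)"
definition cD where "cD c s j = hblock (cD1 c s j) (cD2 c s j)"
definition cDb where "cDb c s j = hblock (cDb1 c s j) (cDb2 c s j)"
definition cS where "cS c s j = vblock (cS1 c s j) (cS2 c s j)"
definition cR where "cR c s j = diagblock (cR1 c s j) (cR2 c s j)"

definition symmetric_matrix :: "real^'k^'k \<Rightarrow> bool" where
  "symmetric_matrix X \<longleftrightarrow> transpose X = X"

definition psd_matrix :: "real^'k^'k \<Rightarrow> bool" where
  "psd_matrix X \<longleftrightarrow> symmetric_matrix X \<and> (\<forall>y. 0 \<le> (X *v y) \<bullet> y)"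

text \<open>
  Membership in \<open>L^p(0,T)\<close> for \<open>p = 1, 2\<close>, and in \<open>L^\<infinity>(0,T)\<close>. Elements of these spaces are
  given by Borel measurable representatives.
\<close>

definition Lp_coeff :: "nat \<Rightarrow> real \<Rightarrow> (real \<Rightarrow> 'b::real_normed_vector) \<Rightarrow> bool" where
  "Lp_coeff p T f \<longleftrightarrow>
     set_borel_measurable lborel {0..T} f \<and>
     (\<integral>\<^sup>+s\<in>{0..T}. ennreal (norm (f s) ^ p) \<partial>lborel) < \<infinity>"

definition Linf_coeff :: "real \<Rightarrow> (real \<Rightarrow> 'b::real_normed_vector) \<Rightarrow> bool" where
  "Linf_coeff T f \<longleftrightarrow>
     set_borel_measurable lborel {0..T} f \<and>
     (\<exists>K. AE s in lborel. s \<in> {0..T} \<longrightarrow> norm (f s) \<le> K)"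

definition regular_coeffs :: "real \<Rightarrow> nat set \<Rightarrow> ('n::finite, 'm::finite, 'v::finite) coeffs \<Rightarrow> bool" where
  "regular_coeffs T S c \<longleftrightarrow>
     (\<forall>j\<in>S.
        Lp_coeff 1 T (\<lambda>s. cA c s j) \<and>
        Lp_coeff 2 T (\<lambda>s. cC c s j) \<and>
        Lp_coeff 2 T (\<lambda>s. cCb c s j) \<and>
        Lp_coeff 2 T (\<lambda>s. cB c s j) \<and>
        Linf_coeff T (\<lambda>s. cD c s j) \<and>
        Linf_coeff T (\<lambda>s. cDb c s j) \<and>
        Lp_coeff 1 T (\<lambda>s. cQ c s j) \<and>
        (AE s in lborel. s \<in> {0..T} \<longrightarrow> symmetric_matrix (cQ c s j)) \<and>
        Lp_coeff 2 T (\<lambda>s. cS c s j) \<and>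
        Linf_coeff T (\<lambda>s. cR c s j) \<and>
        (AE s in lborel. s \<in> {0..T} \<longrightarrow> symmetric_matrix (cR c s j)) \<and>
        symmetric_matrix (cG c j))"

definition positivity_condition :: "real \<Rightarrow> nat set \<Rightarrow> ('n::finite, 'm::finite, 'v::finite) coeffs \<Rightarrow> bool" where
  "positivity_condition T S c \<longleftrightarrow>
     (\<forall>j\<in>S.
        psd_matrix (cG c j) \<and>
        (\<exists>\<delta>>0. AE s in lborel. s \<in> {0..T} \<longrightarrow> psd_matrix (cR c s j - \<delta> *\<^sub>R mat 1)) \<and>
        (AE s in lborel. s \<in> {0..T} \<longrightarrow>
           psd_matrix (cQ c s j - transpose (cS c s j) ** matrix_inv (cR c s j) ** cS c s j)))"


section \<open>The state equation and the game\<close>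

definition drift where
  "drift c \<alpha> x u v s \<omega> =
     cA c s (\<alpha> s \<omega>) *v x s \<omega> + cB1 c s (\<alpha> s \<omega>) *v u s \<omega> + cB2 c s (\<alpha> s \<omega>) *v v s \<omega>"

definition diffusion where
  "diffusion c \<alpha> x u v s \<omega> =
     cC c s (\<alpha> s \<omega>) *v x s \<omega> + cD1 c s (\<alpha> s \<omega>) *v u s \<omega> + cD2 c s (\<alpha> s \<omega>) *v v s \<omega>"

definition diffusion_b where
  "diffusion_b c \<alpha> x u v s \<omega> =
     cCb c s (\<alpha> s \<omega>) *v x s \<omega> + cDb1 c s (\<alpha> s \<omega>) *v u s \<omega> + cDb2 c s (\<alpha> s \<omega>) *v v s \<omega>"

definition solves_state_equation ::
    "'w measure \<Rightarrow> (real \<Rightarrow> 'w \<Rightarrow> real) \<Rightarrow> (real \<Rightarrow> 'w \<Rightarrow> real) \<Rightarrow> (real \<Rightarrow> 'w \<Rightarrow> nat) \<Rightarrow> real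
      \<Rightarrow> ('n::finite, 'm::finite, 'v::finite) coeffs
      \<Rightarrow> (real \<Rightarrow> 'w \<Rightarrow> real^'m) \<Rightarrow> (real \<Rightarrow> 'w \<Rightarrow> real^'v) \<Rightarrow> (real \<Rightarrow> 'w \<Rightarrow> real^'n) \<Rightarrow> bool" where
  "solves_state_equation M W Wb \<alpha> T c u v x \<longleftrightarrow>
     progressive (filtration_F M W Wb \<alpha>) T x \<and>
     (AE \<omega> in M. continuous_on {0..T} (\<lambda>t. x t \<omega>)) \<and>
     (AE \<omega> in M. x 0 \<omega> = 0) \<and>
     (AE \<omega> in M. set_integrable lborel {0..T} (\<lambda>s. drift c \<alpha> x u v s \<omega>)) \<and>
     (\<exists>Y Yb.
        has_ito_integral M (filtration_F M W Wb \<alpha>) T W (diffusion c \<alpha> x u v) Y \<and>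
        has_ito_integral M (filtration_F M W Wb \<alpha>) T Wb (diffusion_b c \<alpha> x u v) Yb \<and>
        (AE \<omega> in M. \<forall>t\<in>{0..T}.
           x t \<omega> = (LBINT s:{0..t}. drift c \<alpha> x u v s \<omega>) + Y t \<omega> + Yb t \<omega>))"

text \<open>
  The solution is unique only up to indistinguishability, hence the choice operator; the cost
  does not depend on the version. The initial regime is that of the given chain \<open>\<alpha>\<close>.
\<close>

definition state_process where
  "state_process M W Wb \<alpha> T c u v = (SOME x. solves_state_equation M W Wb \<alpha> T c u v x)"

definition running_cost where
  "running_cost c \<alpha> x u v s \<omega> =
     (cQ c s (\<alpha> s \<omega>) *v x s \<omega>) \<bullet> x s \<omega>
     + (cR1 c s (\<alpha> s \<omega>) *v u s \<omega>) \<bullet> u s \<omega>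
     + (cR2 c s (\<alpha> s \<omega>) *v v s \<omega>) \<bullet> v s \<omega>
     + 2 * ((cS1 c s (\<alpha> s \<omega>) *v x s \<omega>) \<bullet> u s \<omega>)
     + 2 * ((cS2 c s (\<alpha> s \<omega>) *v x s \<omega>) \<bullet> v s \<omega>)"

definition cost ::
    "'w measure \<Rightarrow> (real \<Rightarrow> 'w \<Rightarrow> real) \<Rightarrow> (real \<Rightarrow> 'w \<Rightarrow> real) \<Rightarrow> (real \<Rightarrow> 'w \<Rightarrow> nat) \<Rightarrow> real
      \<Rightarrow> ('n::finite, 'm::finite, 'v::finite) coeffs
      \<Rightarrow> (real \<Rightarrow> 'w \<Rightarrow> real^'m) \<Rightarrow> (real \<Rightarrow> 'w \<Rightarrow> real^'v) \<Rightarrow> real" where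
  "cost M W Wb \<alpha> T c u v =
     (let x = state_process M W Wb \<alpha> T c u v
      in \<integral>\<omega>. (cG c (\<alpha> T \<omega>) *v x T \<omega>) \<bullet> x T \<omega>
            + (LBINT s:{0..T}. running_cost c \<alpha> x u v s \<omega>) \<partial>M)"

definition cost_gamma ::
    "'w measure \<Rightarrow> (real \<Rightarrow> 'w \<Rightarrow> real) \<Rightarrow> (real \<Rightarrow> 'w \<Rightarrow> real) \<Rightarrow> (real \<Rightarrow> 'w \<Rightarrow> nat) \<Rightarrow> real
      \<Rightarrow> ('n::finite, 'm::finite, 'v::finite) coeffs \<Rightarrow> real
      \<Rightarrow> (real \<Rightarrow> 'w \<Rightarrow> real^'m) \<Rightarrow> (real \<Rightarrow> 'w \<Rightarrow> real^'v) \<Rightarrow> real" where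
  "cost_gamma M W Wb \<alpha> T c \<gamma> u v =
     cost M W Wb \<alpha> T c u v - \<gamma>\<^sup>2 * (\<integral>\<omega>. (LBINT s:{0..T}. (norm (v s \<omega>))\<^sup>2) \<partial>M)"

definition upper_value ::
    "'w measure \<Rightarrow> (real \<Rightarrow> 'w \<Rightarrow> real) \<Rightarrow> (real \<Rightarrow> 'w \<Rightarrow> real) \<Rightarrow> (real \<Rightarrow> 'w \<Rightarrow> nat) \<Rightarrow> real
      \<Rightarrow> ('n::finite, 'm::finite, 'v::finite) coeffs \<Rightarrow> real \<Rightarrow> ereal" where
  "upper_value M W Wb \<alpha> T c \<gamma> =
     (INF u \<in> L2_processes M (filtration_G M W \<alpha>) T.
        SUP v \<in> L2_processes M (filtration_F M W Wb \<alpha>) T.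
          ereal (cost_gamma M W Wb \<alpha> T c \<gamma> u v))"

definition Gamma_bar_set ::
    "'w measure \<Rightarrow> (real \<Rightarrow> 'w \<Rightarrow> real) \<Rightarrow> (real \<Rightarrow> 'w \<Rightarrow> real) \<Rightarrow> (real \<Rightarrow> 'w \<Rightarrow> nat) \<Rightarrow> real
      \<Rightarrow> ('n::finite, 'm::finite, 'v::finite) coeffs \<Rightarrow> real set" where
  "Gamma_bar_set M W Wb \<alpha> T c = {\<gamma>. \<gamma> > 0 \<and> (\<forall>\<gamma>'>\<gamma>. upper_value M W Wb \<alpha> T c \<gamma>' = 0)}"

text \<open>The infimum is taken in the extended reals, so that it is \<open>\<infinity>\<close> for the empty set.\<close>

definition gamma_bar ::
    "'w measure \<Rightarrow> (real \<Rightarrow> 'w \<Rightarrow> real) \<Rightarrow> (real \<Rightarrow> 'w \<Rightarrow> real) \<Rightarrow> (real \<Rightarrow> 'w \<Rightarrow> nat) \<Rightarrow> real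
      \<Rightarrow> ('n::finite, 'm::finite, 'v::finite) coeffs \<Rightarrow> ereal" where
  "gamma_bar M W Wb \<alpha> T c = Inf (ereal ` Gamma_bar_set M W Wb \<alpha> T c)"

end

theory Submission
  imports Defs
begin

text \<open>
  For \<open>v = 0\<close> the cost is nonnegative whatever \<open>u\<close> is, because completing the square
  in \<open>Q - S\<^sup>T R\<^sup>-\<^sup>1 S \<ge> 0\<close> makes the running cost pointwise nonnegative; so every upper value is
  at least \<open>0\<close>. As \<open>J\<^sub>\<gamma>\<close> decreases in \<open>\<gamma>\<close>, an upper value that vanishes at \<open>\<gamma>\<close> vanishes
  at every larger level.
\<close>

lemma symmetric_matrix_inner:
  assumes "symmetric_matrix X"
  shows "(X *v y) \<bullet> z = y \<bullet> (X *v z)"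
  by (metis assms dot_lmul_matrix symmetric_matrix_def vector_transpose_matrix)

lemma matrix_diff_scaled_id_mult: "(R - \<delta> *\<^sub>R mat 1) *v y = R *v y - \<delta> *\<^sub>R y"
  for R :: "real^'k^'k"
  by (simp add: matrix_vector_mult_diff_rdistrib scaleR_matrix_vector_assoc[symmetric])

text \<open>The bound \<open>\<delta> * (y \<bullet> y) \<le> (R *v y) \<bullet> y\<close> forces a
  trivial kernel, which for a square matrix means invertibility. Symmetry passes from the difference
  to \<open>R\<close> because \<open>\<delta> *\<^sub>R mat 1\<close> is itself symmetric.\<close>

lemma uniformly_positive_matrix:
  fixes R :: "real^'k^'k"
  assumes "psd_matrix (R - \<delta> *\<^sub>R mat 1)" and "\<delta> > 0"
  shows "symmetric_matrix R" and "0 \<le> (R *v y) \<bullet> y" and "invertible R"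
proof -
  have ge: "\<delta> * (y \<bullet> y) \<le> (R *v y) \<bullet> y" for y
    using assms(1) by (simp add: psd_matrix_def matrix_diff_scaled_id_mult inner_diff_left)
  then show "0 \<le> (R *v y) \<bullet> y"
    using assms(2) by (meson inner_ge_zero less_imp_le mult_nonneg_nonneg order_trans)
  have "R $ a $ b = R $ b $ a" for a b
  proof -
    have "transpose (R - \<delta> *\<^sub>R mat 1) $ a $ b = (R - \<delta> *\<^sub>R mat 1) $ a $ b"
      using assms(1) by (simp add: psd_matrix_def symmetric_matrix_def)
    then show ?thesis
      by (simp add: transpose_def mat_def split: if_splits)
  qed
  then show "symmetric_matrix R"
    by (simp add: symmetric_matrix_def transpose_def vec_eq_iff)
  have "y = 0" if "R *v y = 0" for y
    using ge[of y] that assms(2) by (simp add: mult_le_0_iff) (metis inner_eq_zero_iff inner_ge_zero order_antisym)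
  then show "invertible R"
    by (simp add: invertible_left_inverse matrix_left_invertible_ker)
qed

lemma matrix_inv_vector_cancel:
  fixes R :: "real^'k^'k"
  assumes "invertible R"
  shows "R *v (matrix_inv R *v y) = y"
proof -
  \<comment> \<open>\<open>matrix_inv\<close> is defined by choice; invertibility supplies the
    witness.\<close>
  have "R ** matrix_inv R = mat 1 \<and> matrix_inv R ** R = mat 1"
    using assms unfolding invertible_def matrix_inv_def by (rule someI_ex)
  then show ?thesis
    by (simp add: matrix_vector_mul_assoc)
qed

text \<open>Completing the square: for symmetric \<open>R\<close> and \<open>w\<close> with
  \<open>R *v w = S *v x\<close>, the form equals \<open>((Q - transpose S ** matrix_inv R ** S) *v
  x) \<bullet> x + (R *v (z + w)) \<bullet> (z + w)\<close>, a sum of two nonnegative terms.\<close>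

lemma quadratic_form_nonneg:
  fixes Q :: "real^'n^'n" and S :: "real^'n^'k" and R :: "real^'k^'k"
  assumes R: "psd_matrix (R - \<delta> *\<^sub>R mat 1)" "\<delta> > 0"
    and Q: "psd_matrix (Q - transpose S ** matrix_inv R ** S)"
  shows "0 \<le> (Q *v x) \<bullet> x + (R *v z) \<bullet> z + 2 * ((S *v x) \<bullet> z)"
proof -
  note Rfacts = uniformly_positive_matrix[OF R]
  define w where "w = matrix_inv R *v (S *v x)"
  have Rw: "R *v w = S *v x"
    unfolding w_def by (rule matrix_inv_vector_cancel[OF Rfacts(3)])
  have "((transpose S ** matrix_inv R ** S) *v x) \<bullet> x = (transpose S *v w) \<bullet> x"
    by (simp add: w_def matrix_vector_mul_assoc matrix_mul_assoc)
  also have "\<dots> = w \<bullet> (S *v x)"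
    by (simp add: dot_lmul_matrix)
  finally have "w \<bullet> (R *v w) \<le> (Q *v x) \<bullet> x"
    using Q
    by (auto simp: Rw psd_matrix_def matrix_vector_mult_diff_rdistrib inner_diff_left dest: spec[of _ x])
  moreover have "0 \<le> (R *v (z + w)) \<bullet> (z + w)"
    by (rule Rfacts(2))
  \<comment> \<open>The cross term of the square: symmetry moves \<open>R\<close> onto
    \<open>w\<close>.\<close>
  moreover have "(R *v z) \<bullet> w = (S *v x) \<bullet> z"
    by (metis Rw Rfacts(1) inner_commute symmetric_matrix_inner)
  ultimately show ?thesis
    by (simp add: Rw matrix_vector_right_distrib inner_add_left inner_add_right
        inner_commute)
qed

lemma sum_UNIV_Plus:
  fixes f :: "'m::finite + 'v::finite \<Rightarrow> real"
  shows "(\<Sum>a\<in>UNIV. f a) = (\<Sum>k\<in>UNIV. f (Inl k)) + (\<Sum>l\<in>UNIV. f (Inr l))"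
  using sum.Plus[of "UNIV :: 'm set" "UNIV :: 'v set" f] by simp

text \<open>The joint control (u, 0). It links the positivity condition, stated for the full block
  matrices, to a cost that at \<open>v = 0\<close> involves only the blocks \<open>cR1\<close> and
  \<open>cS1\<close>.\<close>

definition pad_right :: "real^'m::finite \<Rightarrow> real^('m + 'v::finite)" where
  "pad_right u = (\<chi> a. case a of Inl k \<Rightarrow> u $ k | Inr l \<Rightarrow> 0)"

lemma diagblock_pad_right:
  fixes X :: "real^'m^'m" and Y :: "real^'v^'v"
  shows "(diagblock X Y *v pad_right u) \<bullet> pad_right u = (X *v u) \<bullet> u"
  by (simp add: pad_right_def diagblock_def inner_vec_def matrix_vector_mult_def sum_UNIV_Plus)

lemma vblock_pad_right:
  fixes X :: "real^'n^'m" and Y :: "real^'n^'v"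
  shows "(vblock X Y *v x) \<bullet> pad_right u = (X *v x) \<bullet> u"
  by (simp add: pad_right_def vblock_def inner_vec_def matrix_vector_mult_def sum_UNIV_Plus)

lemma running_cost_zero_nonneg:
  fixes c :: "('n::finite, 'm::finite, 'v::finite) coeffs"
  assumes "psd_matrix (cR c s (\<alpha> s \<omega>) - \<delta> *\<^sub>R mat 1)" "\<delta> > 0"
    and "psd_matrix (cQ c s (\<alpha> s \<omega>) - transpose (cS c s (\<alpha> s \<omega>))
           ** matrix_inv (cR c s (\<alpha> s \<omega>)) ** cS c s (\<alpha> s \<omega>))"
  shows "0 \<le> running_cost c \<alpha> x u (\<lambda>_ _. 0) s \<omega>"
  using quadratic_form_nonneg[OF assms, of "x s \<omega>" "pad_right (u s \<omega>)"]
  by (simp add: running_cost_def cR_def cS_def diagblock_pad_right vblock_pad_right)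

lemma zero_in_L2_processes: "(\<lambda>_ _. 0) \<in> L2_processes M F T"
  by (simp add: L2_processes_def progressive_def)

text \<open>This also covers a non-integrable \<open>f\<close>, whose Bochner integral is 0 by
  convention.\<close>

lemma set_lebesgue_integral_nonneg_AE:
  fixes f :: "'a \<Rightarrow> real"
  assumes "AE s in N. s \<in> A \<longrightarrow> 0 \<le> f s"
  shows "0 \<le> (LINT s:A|N. f s)"
  unfolding set_lebesgue_integral_def
  by (rule integral_nonneg_AE) (use assms in eventually_elim, auto simp: indicator_def)

text \<open>The integrands are nonnegative for every process \<open>x\<close>, hence for the one
  that \<open>state_process\<close> selects.\<close>

lemma cost_zero_nonneg:
  fixes c :: "('n::finite, 'm::finite, 'v::finite) coeffs"
  assumes "finite S" and "0 \<le> T"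
    and state: "\<And>t \<omega>. 0 \<le> t \<Longrightarrow> \<omega> \<in> space M \<Longrightarrow> \<alpha> t \<omega> \<in> S"
    and pos: "positivity_condition T S c"
  shows "0 \<le> cost M W Wb \<alpha> T c u (\<lambda>_ _. 0)"
proof -
  have "\<forall>j\<in>S. \<exists>\<delta>. \<delta> > 0 \<and>
      (AE s in lborel. s \<in> {0..T} \<longrightarrow> psd_matrix (cR c s j - \<delta> *\<^sub>R mat 1))"
    using pos by (simp add: positivity_condition_def)
  from bchoice[OF this] obtain \<delta> where
    \<delta>: "\<forall>j\<in>S. \<delta> j > 0 \<and>
      (AE s in lborel. s \<in> {0..T} \<longrightarrow> psd_matrix (cR c s j - \<delta> j *\<^sub>R mat 1))"
    by blast
  have "AE s in lborel. \<forall>j\<in>S. s \<in> {0..T} \<longrightarrow>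
      psd_matrix (cR c s j - \<delta> j *\<^sub>R mat 1) \<and>
      psd_matrix (cQ c s j - transpose (cS c s j) ** matrix_inv (cR c s j) ** cS c s j)"
  \<comment> \<open>Finitely many regimes give a single null set of times that serves all of them.
    It does not depend on \<open>\<omega>\<close>, so the regime may then be replaced by the random
    \<open>\<alpha> s \<omega>\<close>.\<close>
  proof (rule AE_finite_allI[OF assms(1)])
    fix j assume j: "j \<in> S"
    have "AE s in lborel. s \<in> {0..T} \<longrightarrow>
        psd_matrix (cQ c s j - transpose (cS c s j) ** matrix_inv (cR c s j) ** cS c s j)"
      using pos j by (simp add: positivity_condition_def)
    moreover have "AE s in lborel. s \<in> {0..T} \<longrightarrow> psd_matrix (cR c s j - \<delta> j *\<^sub>R mat 1)"
      using \<delta> j by simp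
    ultimately show "AE s in lborel. s \<in> {0..T} \<longrightarrow>
      psd_matrix (cR c s j - \<delta> j *\<^sub>R mat 1) \<and>
      psd_matrix (cQ c s j - transpose (cS c s j) ** matrix_inv (cR c s j) ** cS c s j)"
      by eventually_elim simp
  qed
  then have run: "AE s in lborel. s \<in> {0..T} \<longrightarrow> 0 \<le> running_cost c \<alpha> x u (\<lambda>_ _. 0) s \<omega>"
    if "\<omega> \<in> space M" for x \<omega>
  proof eventually_elim
    case (elim s)
    show ?case
    proof
      assume s: "s \<in> {0..T}"
      then have "\<alpha> s \<omega> \<in> S"
        using state that by simp
      with elim s \<delta> show "0 \<le> running_cost c \<alpha> x u (\<lambda>_ _. 0) s \<omega>"
        by (intro running_cost_zero_nonneg[where \<delta> = "\<delta> (\<alpha> s \<omega>)"]) simp_all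
    qed
  qed
  have "0 \<le> (cG c (\<alpha> T \<omega>) *v y) \<bullet> y" if "\<omega> \<in> space M" for y \<omega>
    using pos state[OF assms(2) that] by (simp add: positivity_condition_def psd_matrix_def)
  then show ?thesis
    unfolding cost_def Let_def
    by (intro Bochner_Integration.integral_nonneg add_nonneg_nonneg
        set_lebesgue_integral_nonneg_AE run)
qed

text \<open>Against every \<open>u\<close> the choice \<open>v = 0\<close> is admissible; there the
  penalty vanishes and the cost is nonnegative, so each supremum is at least 0.\<close>

lemma upper_value_nonneg:
  fixes c :: "('n::finite, 'm::finite, 'v::finite) coeffs"
  assumes "finite S" and "0 \<le> T"
    and "\<And>t \<omega>. 0 \<le> t \<Longrightarrow> \<omega> \<in> space M \<Longrightarrow> \<alpha> t \<omega> \<in> S"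
    and "positivity_condition T S c"
  shows "0 \<le> upper_value M W Wb \<alpha> T c \<gamma>"
  unfolding upper_value_def
proof (rule INF_greatest)
  fix u :: "real \<Rightarrow> 'a \<Rightarrow> real^'m"
  have "0 \<le> ereal (cost_gamma M W Wb \<alpha> T c \<gamma> u (\<lambda>_ _. 0))"
    using cost_zero_nonneg[OF assms, where W = W and Wb = Wb and u = u]
    by (simp add: cost_gamma_def set_lebesgue_integral_def)
  then show "0 \<le> (SUP v\<in>L2_processes M (filtration_F M W Wb \<alpha>) T.
      ereal (cost_gamma M W Wb \<alpha> T c \<gamma> u v))"
    by (rule SUP_upper2[OF zero_in_L2_processes])
qed

text \<open>A larger level subtracts a larger multiple of the nonnegative energy of
  \<open>v\<close>; the pointwise inequality survives supremum and infimum.\<close>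

lemma upper_value_antimono:
  fixes c :: "('n::finite, 'm::finite, 'v::finite) coeffs"
  assumes "0 \<le> \<gamma>" and "\<gamma> \<le> \<gamma>'"
  shows "upper_value M W Wb \<alpha> T c \<gamma>' \<le> upper_value M W Wb \<alpha> T c \<gamma>"
proof -
  have "0 \<le> (\<integral>\<omega>. (LBINT s:{0..T}. (norm (v s \<omega>))\<^sup>2) \<partial>M)" for v :: "real \<Rightarrow> 'a \<Rightarrow> real^'v"
    by (intro Bochner_Integration.integral_nonneg set_lebesgue_integral_nonneg_AE) simp
  moreover have "\<gamma>\<^sup>2 \<le> \<gamma>'\<^sup>2"
    using assms by (simp add: power_mono)
  ultimately have "cost_gamma M W Wb \<alpha> T c \<gamma>' u v \<le> cost_gamma M W Wb \<alpha> T c \<gamma> u v" for u v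
    by (simp add: cost_gamma_def mult_right_mono)
  then show ?thesis
    unfolding upper_value_def by (intro INF_mono' SUP_mono') simp
qed

theorem corollary3p1:
  fixes M :: "'w measure"
    and W Wb :: "real \<Rightarrow> 'w \<Rightarrow> real"
    and \<alpha> :: "real \<Rightarrow> 'w \<Rightarrow> nat"
    and rate :: "nat \<Rightarrow> nat \<Rightarrow> real"
    and d i :: nat
    and T \<gamma> :: real
    and c :: "('n::finite, 'm::finite, 'v::finite) coeffs"
  assumes "prob_space M" and "complete_measure M"
    and "0 < T"
    and "brownian_motion M W" and "brownian_motion M Wb"
    and "irreducible_markov_chain M {1..d} rate \<alpha>"
    and "\<And>k j. k \<in> {1..d} \<Longrightarrow> j \<in> {1..d} \<Longrightarrow> k \<noteq> j \<Longrightarrow> 0 < rate k j"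
    and "\<And>k. k \<in> {1..d} \<Longrightarrow> (\<Sum>j\<in>{1..d}. rate k j) = 0"
    and "independent_noise M W Wb \<alpha>"
    and "i \<in> {1..d}" and "AE \<omega> in M. \<alpha> 0 \<omega> = i"
    and "regular_coeffs T {1..d} c"
    and "positivity_condition T {1..d} c"
    and "0 < \<gamma>" and "upper_value M W Wb \<alpha> T c \<gamma> = 0"
  shows "ereal \<gamma> \<ge> gamma_bar M W Wb \<alpha> T c"
proof -
  \<comment> \<open>Measurability into \<open>count_space {1..d}\<close> confines the chain to its
    state space at every sample point, not just almost surely.\<close>
  have state: "\<alpha> t \<omega> \<in> {1..d}" if "0 \<le> t" "\<omega> \<in> space M" for t \<omega>
  proof -
    have "\<alpha> t \<in> measurable M (count_space {1..d})"
      using assms(6) that(1) unfolding irreducible_markov_chain_def by blast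
    from measurable_space[OF this that(2)] show ?thesis
      by simp
  qed
  have "upper_value M W Wb \<alpha> T c \<gamma>' = 0" if "\<gamma>' > \<gamma>" for \<gamma>'
  proof (rule antisym)
    show "upper_value M W Wb \<alpha> T c \<gamma>' \<le> 0"
      using upper_value_antimono[of \<gamma> \<gamma>' M W Wb \<alpha> T c] assms that by simp
    show "0 \<le> upper_value M W Wb \<alpha> T c \<gamma>'"
      using assms(3,13) state by (intro upper_value_nonneg[where S = "{1..d}"]) simp_all
  qed
  \<comment> \<open>Membership concerns all levels strictly above \<open>\<gamma>\<close>, which is
    what was just shown; the infimum of the set is then at most \<open>\<gamma>\<close>.\<close>
  then have "\<gamma> \<in> Gamma_bar_set M W Wb \<alpha> T c"
    using assms by (simp add: Gamma_bar_set_def)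
  then show ?thesis
    unfolding gamma_bar_def by (intro Inf_lower imageI)
qed

end
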